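(* Let $c>0$ be an absolute constant such that $e(\ell_q^k)\le c\,q\,k^{(2q+2)/(2q-1)}$ for every real $q\ge 1$ and every integer $k\ge 1$ (such a constant exists by a theorem of Alon and Pudlák). Let $n>1$ be an integer and let $p$ be a real number with $p\ge c(n\log n)^2$. Then $e(\ell_p^n)\le 2(p+1)n$.
   Context: For real $p\ge 1$ and a positive integer $n$, $\ell_p^n=(\mathbb{R}^n,\|\cdot\|_p)$ is $\mathbb{R}^n$ with the norm $\|x\|_p=\left(\sum_{i=1}^n|x_i|^p\right)^{1/p}$ and distance $\|x-y\|_p$. A subset $S$ of a normed space is an equilateral set if the distances between distinct points of $S$ take only one value. $e(X)$ denotes the maximum cardinality of an equilateral set in $X$; thus $e(X)\le N$ means that every equilateral set in $X$ has at most $N$ points. Here $\log$ is the natural logarithm. *)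

theory Defs
  imports Complex_Main "HOL-Library.FuncSet" "HOL-Library.Extended_Real"
begin

text \<open>
  The dimension has to be quantified inside formulas, so real \<open>n\<close>-space is a set of functions
  rather than a type. Extensionality (the value is
  \<^term>\<open>undefined\<close> outside \<^term>\<open>{..<n}\<close>) makes equality of functions agree with equality
  of vectors.
\<close>

definition Rn :: "nat \<Rightarrow> (nat \<Rightarrow> real) set" where
  "Rn n = {..<n} \<rightarrow>\<^sub>E UNIV"

definition lp_norm :: "real \<Rightarrow> nat \<Rightarrow> (nat \<Rightarrow> real) \<Rightarrow> real" where
  "lp_norm p n x = (\<Sum>i<n. \<bar>x i\<bar> powr p) powr (1 / p)"

definition lp_dist :: "real \<Rightarrow> nat \<Rightarrow> (nat \<Rightarrow> real) \<Rightarrow> (nat \<Rightarrow> real) \<Rightarrow> real" where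
  "lp_dist p n x y = lp_norm p n (\<lambda>i. x i - y i)"

definition equilateral :: "('a \<Rightarrow> 'a \<Rightarrow> real) \<Rightarrow> 'a set \<Rightarrow> bool" where
  "equilateral d S \<longleftrightarrow> (\<exists>r. \<forall>x\<in>S. \<forall>y\<in>S. x \<noteq> y \<longrightarrow> d x y = r)"

text \<open>
  The supremum of the cardinalities of the equilateral subsets of \<open>M\<close>. Infinite sets are sent to
  \<open>\<infinity>\<close> explicitly, since \<^const>\<open>card\<close> is 0 on them. A finite value is attained, so it is
  then a maximum.
\<close>

definition equilateral_number :: "'a set \<Rightarrow> ('a \<Rightarrow> 'a \<Rightarrow> real) \<Rightarrow> enat" where
  "equilateral_number M d =
     (SUP S \<in> {S. S \<subseteq> M \<and> equilateral d S}. if finite S then enat (card S) else \<infinity>)"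

definition e_lp :: "real \<Rightarrow> nat \<Rightarrow> enat" where
  "e_lp p n = equilateral_number (Rn n) (lp_dist p n)"

lemma equilateral_number_le_iff:
  fixes N :: real
  assumes "N \<ge> 0"
  shows "ereal_of_enat (equilateral_number M d) \<le> ereal N \<longleftrightarrow>
         (\<forall>S. S \<subseteq> M \<longrightarrow> equilateral d S \<longrightarrow> finite S \<and> real (card S) \<le> N)"
proof -
  have nat_le: "real m \<le> N \<longleftrightarrow> m \<le> nat \<lfloor>N\<rfloor>" for m
    using assms by linarith
  have enat_le: "ereal_of_enat z \<le> ereal N \<longleftrightarrow> z \<le> enat (nat \<lfloor>N\<rfloor>)" for z
    by (cases z) (auto simp: nat_le)
  show ?thesis
    unfolding enat_le equilateral_number_def SUP_le_iff
    by (auto simp: nat_le split: if_splits)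
qed

end

theory Submission
  imports Defs "HOL-Analysis.Convex" "HOL-Analysis.Harmonic_Numbers"
begin

text \<open>
  Scale the equilateral set \<open>S\<close> to distance 1 and let \<open>q\<close> be an even integer with
  \<open>\<bar>q - p\<bar> \<le> 1\<close>. Expanding the powers, the matrix \<open>1 - \<Sum>i. (x i - y i) ^ q\<close> on \<open>S\<close> has rank
  at most \<open>2 + n (q - 1) \<le> (p + 1) n\<close>. Its diagonal is 1, and since the numbers
  \<open>\<bar>x i - y i\<bar> powr p\<close> sum to 1, a power mean inequality bounds the other entries by
  \<open>\<epsilon> = ln n / p * n powr (1 / p)\<close>. Comparing trace, rank and Frobenius norm gives
  \<open>card S \<le> rank * (1 + card S * \<epsilon>\<^sup>2)\<close>, and the assumed a priori bound on \<open>card S\<close> makes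
  \<open>card S * \<epsilon>\<^sup>2 \<le> 1\<close>.
\<close>

section \<open>Linear algebra: trace, rank and Frobenius norm\<close>

text \<open>Gram-Schmidt on functions over \<open>S\<close>, one member of the family at a time. A
  member whose residual vanishes on \<open>S\<close> adds no basis vector, so \<open>r\<close> may
  stay below \<open>card K\<close>.\<close>

lemma orthonormal_basis_for_finite_family:
  fixes f :: "'k \<Rightarrow> 'a \<Rightarrow> real"
  assumes "finite K" and S: "finite S"
  shows "\<exists>(r::nat) e c. r \<le> card K \<and>
    (\<forall>i<r. \<forall>j<r. (\<Sum>x\<in>S. e i x * e j x) = (if i = j then 1 else 0)) \<and>
    (\<forall>k\<in>K. \<forall>x\<in>S. f k x = (\<Sum>j<r. c k j * e j x))"
  using assms(1)
proof induction
  case empty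
  then show ?case by (intro exI[of _ 0]) simp
next
  case (insert k K)
  then obtain r :: nat and e c where r: "r \<le> card K"
    and e: "\<And>i j. i < r \<Longrightarrow> j < r \<Longrightarrow> (\<Sum>x\<in>S. e i x * e j x) = (if i = j then 1 else (0::real))"
    and c: "\<And>k x. k \<in> K \<Longrightarrow> x \<in> S \<Longrightarrow> f k x = (\<Sum>j<r. c k j * e j x)"
    by blast
  define a where "a j = (\<Sum>x\<in>S. f k x * e j x)" for j
  define v where "v x = f k x - (\<Sum>j<r. a j * e j x)" for x
  define t where "t = (\<Sum>x\<in>S. (v x)\<^sup>2)"
  have ortho: "(\<Sum>x\<in>S. v x * e i x) = 0" if "i < r" for i
  proof -
    have "(\<Sum>x\<in>S. v x * e i x) = a i - (\<Sum>x\<in>S. \<Sum>j<r. a j * (e j x * e i x))"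
      by (simp add: v_def a_def left_diff_distrib sum_subtractf sum_distrib_right mult.assoc)
    also have "(\<Sum>x\<in>S. \<Sum>j<r. a j * (e j x * e i x)) = (\<Sum>j<r. a j * (\<Sum>x\<in>S. e j x * e i x))"
      by (subst sum.swap) (simp add: sum_distrib_left)
    also have "\<dots> = (\<Sum>j<r. if j = i then a j else 0)"
      by (rule sum.cong) (use e that in auto)
    also have "\<dots> = a i" using that by simp
    finally show ?thesis by simp
  qed
  show ?case
  proof (cases "t = 0")
    case True
    then have v0: "v x = 0" if "x \<in> S" for x
      using S that by (simp add: t_def sum_nonneg_eq_0_iff)
    show ?thesis
    proof (intro exI[of _ r] exI[of _ e] exI[of _ "c(k := a)"] conjI ballI allI impI)
      show "r \<le> card (insert k K)" using r insert.hyps by simp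
      show "(\<Sum>x\<in>S. e i x * e j x) = (if i = j then 1 else 0)" if "i < r" "j < r" for i j
        using e that by blast
      fix l x assume "l \<in> insert k K" and x: "x \<in> S"
      then show "f l x = (\<Sum>j<r. (c(k := a)) l j * e j x)"
        using v0[OF x] c[OF _ x, of l] by (cases "l = k") (auto simp: v_def)
    qed
  next
    case False
    then have t: "t > 0" by (simp add: t_def sum_nonneg order_less_le)
    define e' where "e' = e(r := \<lambda>x. v x / sqrt t)"
    \<comment> \<open>The residual is \<open>sqrt t\<close> times the new unit vector. Induction
      says nothing about the coefficients of the old members at \<open>r\<close>, so they are reset
      to 0.\<close>
    define c' where "c' l = (if l = k then a(r := sqrt t) else (c l)(r := 0))" for l
    show ?thesis
    proof (intro exI[of _ "Suc r"] exI[of _ e'] exI[of _ c'] conjI ballI allI impI)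
      show "Suc r \<le> card (insert k K)" using r insert.hyps by simp
      fix i j assume ij: "i < Suc r" "j < Suc r"
      have "(\<Sum>x\<in>S. v x / sqrt t * (v x / sqrt t)) = t / (sqrt t)\<^sup>2"
        unfolding t_def sum_divide_distrib by (simp add: power2_eq_square)
      then have rr: "(\<Sum>x\<in>S. v x / sqrt t * (v x / sqrt t)) = 1" using t by simp
      have r0: "(\<Sum>x\<in>S. v x / sqrt t * e i x) = 0" if "i < r" for i
        using ortho[OF that] by (simp add: sum_divide_distrib[symmetric])
      then have r1: "(\<Sum>x\<in>S. e i x * (v x / sqrt t)) = 0" if "i < r" for i
        using that by (simp add: mult.commute)
      show "(\<Sum>x\<in>S. e' i x * e' j x) = (if i = j then 1 else 0)"
        using ij e[of i j] rr r0[of j] r1[of i]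
        by (cases "i = r"; cases "j = r") (auto simp: e'_def)
    next
      fix l x assume "l \<in> insert k K" and x: "x \<in> S"
      then show "f l x = (\<Sum>j<Suc r. c' l j * e' j x)"
        using c[OF _ x, of l] t by (cases "l = k") (auto simp: v_def e'_def c'_def)
    qed
  qed
qed

text \<open>
  With \<open>f\<close> replaced by an orthonormal family \<open>e\<close>, the matrix is \<open>\<Sum>j. e j x * h j y\<close>; its trace is
  the sum of the \<open>\<langle>e j, h j\<rangle>\<close> and the square of its Frobenius norm is the sum of the \<open>\<parallel>h j\<parallel>\<^sup>2\<close>.
\<close>
lemma trace_squared_le_rank_times_frobenius:
  fixes f g :: "'k \<Rightarrow> 'a \<Rightarrow> real"
  assumes "finite K" and S: "finite S"
    and A: "\<And>x y. x \<in> S \<Longrightarrow> y \<in> S \<Longrightarrow> A x y = (\<Sum>k\<in>K. f k x * g k y)"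
  shows "(\<Sum>x\<in>S. A x x)\<^sup>2 \<le> real (card K) * (\<Sum>x\<in>S. \<Sum>y\<in>S. (A x y)\<^sup>2)"
proof -
  obtain r :: nat and e c where r: "r \<le> card K"
    and e: "\<And>i j. i < r \<Longrightarrow> j < r \<Longrightarrow> (\<Sum>x\<in>S. e i x * e j x) = (if i = j then 1 else (0::real))"
    and c: "\<And>k x. k \<in> K \<Longrightarrow> x \<in> S \<Longrightarrow> f k x = (\<Sum>j<r. c k j * e j x)"
    using orthonormal_basis_for_finite_family[OF assms(1,2), of f] by blast
  define h where "h j y = (\<Sum>k\<in>K. c k j * g k y)" for j y
  have A': "A x y = (\<Sum>j<r. e j x * h j y)" if "x \<in> S" "y \<in> S" for x y
  proof -
    have "A x y = (\<Sum>k\<in>K. \<Sum>j<r. c k j * e j x * g k y)"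
      using that by (simp add: A c sum_distrib_right)
    also have "\<dots> = (\<Sum>j<r. \<Sum>k\<in>K. c k j * e j x * g k y)" by (rule sum.swap)
    finally show ?thesis by (simp add: h_def sum_distrib_left mult_ac)
  qed
  \<comment> \<open>Parseval for one column: its coordinates in the orthonormal family
    \<open>e\<close> are the numbers \<open>h j y\<close>.\<close>
  have frob: "(\<Sum>x\<in>S. (A x y)\<^sup>2) = (\<Sum>j<r. (h j y)\<^sup>2)" if y: "y \<in> S" for y
  proof -
    have "(\<Sum>x\<in>S. (A x y)\<^sup>2) = (\<Sum>x\<in>S. \<Sum>i<r. \<Sum>j<r. h i y * h j y * (e i x * e j x))"
      using y by (simp add: A' power2_eq_square sum_product mult_ac)
    also have "\<dots> = (\<Sum>i<r. \<Sum>x\<in>S. \<Sum>j<r. h i y * h j y * (e i x * e j x))"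
      by (rule sum.swap)
    also have "\<dots> = (\<Sum>i<r. \<Sum>j<r. h i y * h j y * (\<Sum>x\<in>S. e i x * e j x))"
      by (subst sum.swap) (simp add: sum_distrib_left)
    also have "\<dots> = (\<Sum>i<r. \<Sum>j<r. if j = i then h i y * h j y else 0)"
      by (intro sum.cong refl) (use e in auto)
    finally show ?thesis by (simp add: power2_eq_square)
  qed
  define b where "b j = (\<Sum>x\<in>S. e j x * h j x)" for j
  have "(\<Sum>x\<in>S. A x x) = (\<Sum>j<r. b j)"
    unfolding b_def by (subst sum.swap) (simp add: A')
  \<comment> \<open>Cauchy-Schwarz is used twice: here over the \<open>r\<close> indices, and below
    for each \<open>b j\<close>, where \<open>e j\<close> has norm 1.\<close>
  then have "(\<Sum>x\<in>S. A x x)\<^sup>2 \<le> (\<Sum>j<r. (b j)\<^sup>2) * r"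
    using sum_squared_le_sum_of_squares[of b "{..<r}"] by simp
  also have "\<dots> \<le> (\<Sum>j<r. \<Sum>y\<in>S. (h j y)\<^sup>2) * card K"
  proof (intro mult_mono sum_mono sum_nonneg)
    fix j assume "j \<in> {..<r}"
    then show "(b j)\<^sup>2 \<le> (\<Sum>y\<in>S. (h j y)\<^sup>2)"
      using Cauchy_Schwarz_ineq_sum[of "e j" "h j" S] e[of j j]
      by (simp add: b_def power2_eq_square)
  qed (use r in auto)
  also have "(\<Sum>j<r. \<Sum>y\<in>S. (h j y)\<^sup>2) = (\<Sum>y\<in>S. \<Sum>x\<in>S. (A x y)\<^sup>2)"
    by (subst sum.swap) (simp add: frob)
  also have "\<dots> = (\<Sum>x\<in>S. \<Sum>y\<in>S. (A x y)\<^sup>2)" by (rule sum.swap)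
  finally show ?thesis by (simp add: mult.commute)
qed

text \<open>The trace is \<open>card S\<close>, and each row adds at most
  \<open>1 + card S * \<epsilon>\<^sup>2\<close> to the squared Frobenius norm; one factor
  \<open>card S\<close> cancels.\<close>

corollary card_le_of_near_identity:
  fixes f g :: "'k \<Rightarrow> 'a \<Rightarrow> real"
  assumes "finite K" and "finite S"
    and A: "\<And>x y. x \<in> S \<Longrightarrow> y \<in> S \<Longrightarrow> A x y = (\<Sum>k\<in>K. f k x * g k y)"
    and diag: "\<And>x. x \<in> S \<Longrightarrow> A x x = 1"
    and off: "\<And>x y. x \<in> S \<Longrightarrow> y \<in> S \<Longrightarrow> x \<noteq> y \<Longrightarrow> \<bar>A x y\<bar> \<le> \<epsilon>"
  shows "real (card S) \<le> real (card K) * (1 + real (card S) * \<epsilon>\<^sup>2)"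
proof (cases "S = {}")
  case False
  define N where "N = real (card S)"
  have N: "N > 0" using False assms(2) by (simp add: N_def card_gt_0_iff)
  have row: "(\<Sum>y\<in>S. (A x y)\<^sup>2) \<le> 1 + N * \<epsilon>\<^sup>2" if x: "x \<in> S" for x
  proof -
    have "(\<Sum>y\<in>S. (A x y)\<^sup>2) \<le> (\<Sum>y\<in>S. (if y = x then 1 else 0) + \<epsilon>\<^sup>2)"
    proof (rule sum_mono)
      fix y assume y: "y \<in> S"
      show "(A x y)\<^sup>2 \<le> (if y = x then 1 else 0) + \<epsilon>\<^sup>2"
        using diag[OF x] power_mono[OF off[OF x y], of 2] by auto
    qed
    also have "\<dots> = 1 + N * \<epsilon>\<^sup>2" using x assms(2) by (simp add: sum.distrib N_def)
    finally show ?thesis .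
  qed
  have "N\<^sup>2 = (\<Sum>x\<in>S. A x x)\<^sup>2" by (simp add: diag N_def)
  also have "\<dots> \<le> real (card K) * (\<Sum>x\<in>S. \<Sum>y\<in>S. (A x y)\<^sup>2)"
    by (rule trace_squared_le_rank_times_frobenius[OF assms(1-3)])
  also have "\<dots> \<le> real (card K) * (\<Sum>x\<in>S. 1 + N * \<epsilon>\<^sup>2)"
    by (intro mult_left_mono sum_mono row) auto
  also have "\<dots> = N * (real (card K) * (1 + N * \<epsilon>\<^sup>2))" by (simp add: N_def)
  finally show ?thesis using N by (simp add: power2_eq_square N_def)
qed simp

section \<open>Power sums of nonnegative numbers with sum 1\<close>

text \<open>The bounds by 1 hold termwise against \<open>w i\<close>, since
  \<open>0 \<le> w i \<le> 1\<close>. The others compare the power of \<open>n * w i\<close> with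
  its tangent line at 1; the numbers \<open>n * w i\<close> have mean 1, so the tangent values sum
  to \<open>n\<close>.\<close>

lemma sum_powr_bounds:
  fixes w :: "nat \<Rightarrow> real"
  assumes n: "n > 0" and s: "s > 0" and w: "\<And>i. i < n \<Longrightarrow> 0 \<le> w i" and sum1: "(\<Sum>i<n. w i) = 1"
  shows "s \<ge> 1 \<Longrightarrow> real n powr (1 - s) \<le> (\<Sum>i<n. w i powr s) \<and> (\<Sum>i<n. w i powr s) \<le> 1"
    and "s \<le> 1 \<Longrightarrow> 1 \<le> (\<Sum>i<n. w i powr s) \<and> (\<Sum>i<n. w i powr s) \<le> real n powr (1 - s)"
proof -
  have young: "u powr a \<le> a * u + (1 - a)" if "0 < a" "a \<le> 1" "0 \<le> u" for a u :: real
    using that Youngs_inequality_0[of a "1 - a" u 1] by (cases "u = 0") auto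
  have w1: "w i \<le> 1" if "i < n" for i
    using member_le_sum[of i "{..<n}" w] w sum1 that by simp
  have scale: "(\<Sum>i<n. (n * w i) powr s) = real n powr s * (\<Sum>i<n. w i powr s)"
    by (simp add: sum_distrib_left powr_mult w)
  have total: "(\<Sum>i<n. s * (n * w i) + (1 - s)) = n"
    by (simp add: sum.distrib sum_distrib_left[symmetric] sum1 right_diff_distrib)
  have split: "real n = real n powr s * real n powr (1 - s)"
    using n by (simp add: powr_add[symmetric])
  {
    assume "s \<ge> 1"
    have "s * (n * w i) + (1 - s) \<le> (n * w i) powr s" if "i < n" for i
    proof -
      \<comment> \<open>The convex case follows from the concave one with exponent
        \<open>1/s\<close>, applied to the \<open>s\<close>-th power.\<close>
      have "((n * w i) powr s) powr (1/s) \<le> (1/s) * (n * w i) powr s + (1 - 1/s)"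
        by (rule young) (use \<open>s \<ge> 1\<close> in auto)
      then have "n * w i \<le> (1/s) * (n * w i) powr s + (1 - 1/s)"
        using s w[OF that] by (simp add: powr_powr)
      then have "s * (n * w i) \<le> s * ((1/s) * (n * w i) powr s + (1 - 1/s))"
        using s by (intro mult_left_mono) auto
      also have "\<dots> = (n * w i) powr s + (s - 1)"
        using s by (simp add: right_diff_distrib distrib_left)
      finally show ?thesis by simp
    qed
    then have "(\<Sum>i<n. s * (n * w i) + (1 - s)) \<le> (\<Sum>i<n. (n * w i) powr s)"
      by (intro sum_mono) auto
    then have "real n \<le> (\<Sum>i<n. (n * w i) powr s)" unfolding total .
    then have "real n powr s * real n powr (1 - s) \<le> real n powr s * (\<Sum>i<n. w i powr s)"
      unfolding scale split[symmetric] .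
    then have "real n powr (1 - s) \<le> (\<Sum>i<n. w i powr s)"
      by (rule mult_left_le_imp_le) (use n in simp)
    moreover have "(\<Sum>i<n. w i powr s) \<le> (\<Sum>i<n. w i)"
    proof (rule sum_mono)
      fix i assume "i \<in> {..<n}"
      then show "w i powr s \<le> w i"
        using w w1 \<open>s \<ge> 1\<close> powr_mono'[of 1 s "w i"] by simp
    qed
    ultimately show "real n powr (1 - s) \<le> (\<Sum>i<n. w i powr s) \<and> (\<Sum>i<n. w i powr s) \<le> 1"
      using sum1 by simp
  }
  {
    assume "s \<le> 1"
    have "(\<Sum>i<n. (n * w i) powr s) \<le> (\<Sum>i<n. s * (n * w i) + (1 - s))"
      by (intro sum_mono young) (use s w \<open>s \<le> 1\<close> in auto)
    then have "(\<Sum>i<n. (n * w i) powr s) \<le> n" unfolding total .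
    then have "real n powr s * (\<Sum>i<n. w i powr s) \<le> real n powr s * real n powr (1 - s)"
      unfolding scale split[symmetric] .
    then have "(\<Sum>i<n. w i powr s) \<le> real n powr (1 - s)"
      by (rule mult_left_le_imp_le) (use n in simp)
    moreover have "(\<Sum>i<n. w i) \<le> (\<Sum>i<n. w i powr s)"
    proof (rule sum_mono)
      fix i assume "i \<in> {..<n}"
      then show "w i \<le> w i powr s"
        using w w1 \<open>s \<le> 1\<close> powr_mono'[of s 1 "w i"] by simp
    qed
    ultimately show "1 \<le> (\<Sum>i<n. w i powr s) \<and> (\<Sum>i<n. w i powr s) \<le> real n powr (1 - s)"
      using sum1 by simp
  }
qed

text \<open>The sum lies between \<open>exp (- x)\<close> and \<open>exp x\<close> for
  \<open>x = d * ln n\<close>, and \<open>exp t \<ge> 1 + t\<close> puts both ends within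
  \<open>x * exp x\<close> of 1.\<close>

lemma sum_powr_close_to_1:
  fixes w :: "nat \<Rightarrow> real"
  assumes n: "n > 0" and s: "s > 0" and w: "\<And>i. i < n \<Longrightarrow> 0 \<le> w i" and sum1: "(\<Sum>i<n. w i) = 1"
    and d: "\<bar>s - 1\<bar> \<le> d"
  shows "\<bar>1 - (\<Sum>i<n. w i powr s)\<bar> \<le> d * ln n * real n powr d"
proof -
  define x where "x = d * ln n"
  have n1: "real n \<ge> 1" using n by simp
  have x0: "x \<ge> 0" using d n1 by (simp add: x_def)
  have E: "real n powr d = exp x" "real n powr (- d) = exp (- x)"
    using n by (simp_all add: powr_def x_def)
  have low: "1 - exp (- x) \<le> x"
    using exp_ge_add_one_self[of "- x"] by simp
  have "(1 - exp (- x)) * exp x \<le> x * exp x"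
    using low by (intro mult_right_mono) auto
  then have up: "exp x - 1 \<le> x * exp x" by (simp add: algebra_simps exp_minus)
  have "x * 1 \<le> x * exp x" using x0 by (intro mult_left_mono) auto
  then have low': "1 - exp (- x) \<le> x * exp x" using low by simp
  have "\<bar>1 - (\<Sum>i<n. w i powr s)\<bar> \<le> x * exp x"
  proof (cases "s \<ge> 1")
    case True
    have "exp (- x) \<le> real n powr (1 - s)"
      unfolding E[symmetric] using d n1 by (intro powr_mono) auto
    then show ?thesis using sum_powr_bounds(1)[OF n s w sum1 True] low' by auto
  next
    case False
    have "real n powr (1 - s) \<le> exp x"
      unfolding E[symmetric] using d n1 by (intro powr_mono) auto
    then show ?thesis using sum_powr_bounds(2)[OF n s w sum1] False up by auto
  qed
  then show ?thesis by (simp add: x_def E)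
qed

section \<open>The matrix of an equilateral set\<close>

lemma lp_norm_powr:
  assumes "p > 0"
  shows "lp_norm p n x powr p = (\<Sum>i<n. \<bar>x i\<bar> powr p)"
  using assms by (simp add: lp_norm_def powr_powr sum_nonneg)

lemma lp_dist_pos:
  assumes "x \<in> Rn n" "y \<in> Rn n" "x \<noteq> y" "p > 0"
  shows "lp_dist p n x y > 0"
proof -
  \<comment> \<open>Points of \<open>Rn n\<close> agree outside \<open>{..<n}\<close>, so distinct
    ones differ at a coordinate that the norm sees.\<close>
  have "\<exists>i<n. x i \<noteq> y i"
  proof (rule ccontr)
    assume "\<not> ?thesis"
    then have "x = y"
      by (intro PiE_ext[OF assms(1,2)[unfolded Rn_def]]) auto
    with assms(3) show False by simp
  qed
  then obtain i where i: "i < n" "x i \<noteq> y i" by blast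
  have "0 < \<bar>x i - y i\<bar> powr p" using i by simp
  also have "\<dots> \<le> (\<Sum>i<n. \<bar>x i - y i\<bar> powr p)"
    using i by (intro member_le_sum) auto
  finally show ?thesis by (simp add: lp_dist_def lp_norm_def)
qed

text \<open>As \<open>q\<close> is even, \<open>\<bar>t\<bar> ^ q\<close> is the polynomial
  \<open>t ^ q\<close>. Its binomial terms in \<open>x\<close> alone, summed over all coordinates,
  form a single rank-one term, and so do those in \<open>y\<close> alone; each coordinate adds
  \<open>q - 1\<close> mixed terms.\<close>

lemma card_equilateral_le:
  fixes p :: real and q n :: nat
  assumes n: "n > 0" and p: "p > 0" and q: "even q" "q > 0" "\<bar>real q - p\<bar> \<le> 1"
    and S: "S \<subseteq> Rn n" "finite S" "equilateral (lp_dist p n) S"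
  defines "\<epsilon> \<equiv> ln n / p * real n powr (1 / p)"
  shows "real (card S) \<le> (2 + n * (real q - 1)) * (1 + real (card S) * \<epsilon>\<^sup>2)"
proof -
  \<comment> \<open>If \<open>S\<close> has at most one point, \<open>r\<close> is arbitrary and may
    be 0; its positivity is derived only from a pair of distinct points.\<close>
  obtain r where r: "\<And>x y. x \<in> S \<Longrightarrow> y \<in> S \<Longrightarrow> x \<noteq> y \<Longrightarrow> lp_dist p n x y = r"
    using S(3) by (auto simp: equilateral_def)
  define A where "A x y = 1 - (\<Sum>i<n. (x i / r - y i / r) ^ q)" for x y :: "nat \<Rightarrow> real"
  \<comment> \<open>The first component \<open>n\<close> is a spare label: \<open>(n, 0)\<close>
    carries the constant and the pure powers of \<open>y\<close>, \<open>(n, 1)\<close> those of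
    \<open>x\<close>.\<close>
  define K where "K = insert (n, 0) (insert (n, 1) ({..<n} \<times> {1..<q}))"
  define f where "f k x = (if k = (n, 0) then 1 else if k = (n, 1) then (\<Sum>i<n. (x i / r) ^ q)
      else (x (fst k) / r) ^ snd k)" for k :: "nat \<times> nat" and x :: "nat \<Rightarrow> real"
  define g where "g k y = (if k = (n, 0) then 1 - (\<Sum>i<n. (- (y i / r)) ^ q) else if k = (n, 1) then - 1
      else - (real (q choose snd k) * (- (y (fst k) / r)) ^ (q - snd k)))"
    for k :: "nat \<times> nat" and y :: "nat \<Rightarrow> real"
  have cardK: "card K = 2 + n * (q - 1)"
    unfolding K_def by (subst card_insert_disjoint; simp)+
  have fact: "A x y = (\<Sum>k\<in>K. f k x * g k y)" for x y
  proof -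
    have ends: "(\<Sum>j\<le>q. F j) = F 0 + F q + (\<Sum>j\<in>{1..<q}. F j)" for F :: "nat \<Rightarrow> real"
    proof -
      have "{..q} = insert 0 (insert q {1..<q})" using q by auto
      then show ?thesis using q by simp
    qed
    have "(x i / r - y i / r) ^ q = (x i / r) ^ q + (- (y i / r)) ^ q +
        (\<Sum>j\<in>{1..<q}. real (q choose j) * (x i / r) ^ j * (- (y i / r)) ^ (q - j))" for i
      using binomial_ring[of "x i / r" "- (y i / r)" q] by (simp add: ends)
    then have "A x y = 1 - (\<Sum>i<n. (- (y i / r)) ^ q) - (\<Sum>i<n. (x i / r) ^ q)
        - (\<Sum>i<n. \<Sum>j\<in>{1..<q}. real (q choose j) * (x i / r) ^ j * (- (y i / r)) ^ (q - j))"
      by (simp add: A_def sum.distrib)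
    also have "(\<Sum>i<n. \<Sum>j\<in>{1..<q}. real (q choose j) * (x i / r) ^ j * (- (y i / r)) ^ (q - j))
        = - (\<Sum>k\<in>{..<n} \<times> {1..<q}. f k x * g k y)"
      unfolding sum.cartesian_product sum_negf[symmetric]
      by (rule sum.cong) (auto simp: f_def g_def)
    finally show ?thesis by (simp add: K_def) (simp add: f_def g_def)
  qed
  have diag: "A x x = 1" for x using q by (simp add: A_def)
  have off: "\<bar>A x y\<bar> \<le> \<epsilon>" if xy: "x \<in> S" "y \<in> S" "x \<noteq> y" for x y
  proof -
    have r0: "r > 0" using lp_dist_pos[of x n y p] r[OF xy] xy S(1) p by auto
    \<comment> \<open>The weights sum to 1, and their powers with exponent \<open>q / p\<close>,
      which is within \<open>1 / p\<close> of 1, are the entries' summands.\<close>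
    define w where "w i = (\<bar>x i - y i\<bar> / r) powr p" for i
    have "(\<Sum>i<n. \<bar>x i - y i\<bar> powr p) = r powr p"
      using r[OF xy] lp_norm_powr[OF p, of n "\<lambda>i. x i - y i"] by (simp add: lp_dist_def)
    then have sum1: "(\<Sum>i<n. w i) = 1"
      using r0 by (simp add: w_def powr_divide sum_divide_distrib[symmetric])
    have "(x i / r - y i / r) ^ q = w i powr (q / p)" for i
    proof -
      have "(x i / r - y i / r) ^ q = (\<bar>x i - y i\<bar> / r) ^ q"
        using q(1) r0 by (simp add: diff_divide_distrib[symmetric] power_divide power_even_abs)
      also have "\<dots> = (\<bar>x i - y i\<bar> / r) powr q"
        using r0 q(2) by (subst powr_realpow') auto
      finally show ?thesis using p by (simp add: w_def powr_powr)
    qed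
    then have "\<bar>A x y\<bar> = \<bar>1 - (\<Sum>i<n. w i powr (q / p))\<bar>" by (simp add: A_def)
    also have "\<dots> \<le> 1 / p * ln n * real n powr (1 / p)"
    proof (rule sum_powr_close_to_1[OF n _ _ sum1])
      have "real q / p - 1 = (real q - p) / p" using p by (simp add: diff_divide_distrib)
      then show "\<bar>real q / p - 1\<bar> \<le> 1 / p" using q(3) p by (simp add: divide_right_mono)
    qed (use p q in \<open>auto simp: w_def\<close>)
    finally show ?thesis by (simp add: \<epsilon>_def)
  qed
  have "real (card S) \<le> real (card K) * (1 + real (card S) * \<epsilon>\<^sup>2)"
    by (rule card_le_of_near_identity[of K S A f g]) (use S fact diag off in \<open>auto simp: K_def\<close>)
  then show ?thesis using q(2) by (simp add: cardK of_nat_diff)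
qed

section \<open>Numerical estimates and the final bound\<close>

text \<open>
  The hypothesis at \<open>q = k = 1\<close>; it forces \<open>p \<ge> 15 / 4\<close> in the theorem, which is barely enough
  for \<open>3 / (2 p - 1) + 2 / p \<le> 1\<close>.
\<close>
lemma equilateral_bound_constant_ge_2:
  assumes "ereal_of_enat (e_lp 1 1) \<le> ereal c" "c > 0"
  shows "c \<ge> 2"
proof -
  define u v where "u = (\<lambda>i\<in>{..<1::nat}. 0::real)" and "v = (\<lambda>i\<in>{..<1::nat}. 1::real)"
  have ne: "u \<noteq> v"
  proof
    assume "u = v"
    then have "u 0 = v 0" by simp
    then show False by (simp add: u_def v_def)
  qed
  have "{u, v} \<subseteq> Rn 1" by (auto simp: u_def v_def Rn_def)
  moreover have "equilateral (lp_dist 1 1) {u, v}"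
    unfolding equilateral_def
    by (intro exI[of _ 1]) (auto simp: u_def v_def lp_dist_def lp_norm_def)
  ultimately have "real (card {u, v}) \<le> c"
    using assms unfolding e_lp_def by (subst (asm) equilateral_number_le_iff) auto
  then show ?thesis using ne by simp
qed

text \<open>Just precise enough: \<open>2 * (2 * (11/16))\<^sup>2 = 121/32\<close> exceeds
  \<open>15/4\<close>.\<close>

lemma ln2_ge_11_16: "ln (2::real) \<ge> 11 / 16"
  using ln_approx_bounds[of 2 2] by (simp add: eval_nat_numeral)

theorem theorem2:
  fixes c p :: real and n :: nat
  assumes "c > 0"
    and "\<And>(q::real) (k::nat). q \<ge> 1 \<Longrightarrow> k \<ge> 1 \<Longrightarrow>
           ereal_of_enat (e_lp q k) \<le> ereal (c * q * real k powr ((2 * q + 2) / (2 * q - 1)))"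
    and "n > 1"
    and "p \<ge> c * (real n * ln (real n))\<^sup>2"
  shows "ereal_of_enat (e_lp p n) \<le> ereal (2 * (p + 1) * real n)"
proof -
  define L where "L = ln (real n)"
  have n2: "real n \<ge> 2" using assms(3) by simp
  have c2: "c \<ge> 2"
    using equilateral_bound_constant_ge_2 assms(1) assms(2)[of 1 1] by simp
  have L: "L \<ge> 11 / 16"
    using ln2_ge_11_16 ln_le_cancel_iff[of 2 "real n"] n2 unfolding L_def by linarith
  have "2 * (2 * (11/16))\<^sup>2 \<le> c * (real n * L)\<^sup>2"
    using c2 n2 L by (intro mult_mono power_mono) auto
  then have p: "p \<ge> 15 / 4" using assms(4) by (simp add: L_def power2_eq_square)
  \<comment> \<open>The even integer with \<open>p - 1 < q \<le> p + 1\<close>; the upper end gives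
    \<open>n * (q - 1) \<le> n * p\<close> in the rank estimate.\<close>
  define q where "q = 2 * nat \<lfloor>(p + 1) / 2\<rfloor>"
  have q: "even q" "q > 0" "\<bar>real q - p\<bar> \<le> 1"
  proof -
    show "even q" by (simp add: q_def)
    have fl: "\<lfloor>(p + 1) / 2\<rfloor> \<ge> 1" using p by simp
    then show "q > 0" by (simp add: q_def)
    have q': "real q = 2 * real_of_int \<lfloor>(p + 1) / 2\<rfloor>" using fl by (simp add: q_def)
    have "real q / 2 \<le> (p + 1) / 2" "(p + 1) / 2 < real q / 2 + 1"
      using of_int_floor_le[of "(p + 1) / 2"] floor_correct[of "(p + 1) / 2"] unfolding q' by simp_all
    then show "\<bar>real q - p\<bar> \<le> 1" by (simp add: abs_le_iff)
  qed
  show ?thesis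
    unfolding e_lp_def
  proof (subst equilateral_number_le_iff, use p n2 in simp, intro allI impI)
    fix S assume S: "S \<subseteq> Rn n" "equilateral (lp_dist p n) S"
    define N where "N = real (card S)"
    \<comment> \<open>The assumed bound at exponent \<open>p\<close> and dimension \<open>n\<close>
      yields the finiteness of \<open>S\<close> as well as a first estimate of its size.\<close>
    have "ereal_of_enat (equilateral_number (Rn n) (lp_dist p n))
        \<le> ereal (c * p * real n powr ((2 * p + 2) / (2 * p - 1)))"
      using assms(2)[of p n] p assms(3) by (simp add: e_lp_def)
    then have fin: "finite S" and "N \<le> c * p * real n powr ((2 * p + 2) / (2 * p - 1))"
      using S p assms(1) by (simp_all add: equilateral_number_le_iff N_def)
    moreover have "(2 * p + 2) / (2 * p - 1) = 1 + 3 / (2 * p - 1)"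
      using p by (simp add: field_simps)
    ultimately have N: "N \<le> c * p * (real n powr (1 + 3 / (2 * p - 1)))" by simp
    define \<epsilon> where "\<epsilon> = L / p * real n powr (1 / p)"
    have \<epsilon>2: "\<epsilon>\<^sup>2 = L\<^sup>2 / p\<^sup>2 * real n powr (2 / p)"
      by (simp add: \<epsilon>_def power_mult_distrib power_divide power2_eq_square powr_add[symmetric])
    \<comment> \<open>Here \<open>13/2 = 2 * (15/4) - 1\<close>, and
      \<open>6/13 + 8/15 = 194/195\<close>.\<close>
    have "3 / (2 * p - 1) \<le> 3 / (13 / 2)" "2 / p \<le> 2 / (15 / 4)"
      using p by (intro divide_left_mono; simp)+
    then have expo: "1 + 3 / (2 * p - 1) + 2 / p \<le> 2" by simp
    \<comment> \<open>The powers of \<open>n\<close> from the first estimate and from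
      \<open>\<epsilon>\<^sup>2\<close> have total exponent at most 2, which is what the lower bound
      on \<open>p\<close> can absorb.\<close>
    have "N * \<epsilon>\<^sup>2 \<le> c * p * (real n powr (1 + 3 / (2 * p - 1))) * \<epsilon>\<^sup>2"
      using N by (intro mult_right_mono) auto
    also have "\<dots> = c * L\<^sup>2 / p * real n powr (1 + 3 / (2 * p - 1) + 2 / p)"
      using p unfolding \<epsilon>2 powr_add by (simp add: power2_eq_square)
    also have "\<dots> \<le> c * L\<^sup>2 / p * real n powr 2"
      using n2 p assms(1) by (intro mult_left_mono powr_mono[OF expo]) auto
    also have "\<dots> = c * (real n * L)\<^sup>2 / p"
      using n2 by (simp add: powr_numeral power_mult_distrib)
    also have "\<dots> \<le> 1" using assms(4) p by (simp add: L_def)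
    finally have N\<epsilon>: "N * \<epsilon>\<^sup>2 \<le> 1" .
    have "n * (real q - 1) \<le> n * p" using q(3) by (intro mult_left_mono) auto
    \<comment> \<open>The summand 2 is absorbed by \<open>n \<ge> 2\<close>.\<close>
    then have rank: "2 + n * (real q - 1) \<le> (p + 1) * n" using n2 by (simp add: algebra_simps)
    have q1: "real q \<ge> 1" using q(2) by simp
    have "N \<le> (2 + n * (real q - 1)) * (1 + N * \<epsilon>\<^sup>2)"
      using card_equilateral_le[of n p q S] assms(3) p q S fin by (simp add: N_def \<epsilon>_def L_def)
    also have "\<dots> \<le> (2 + n * (real q - 1)) * 2"
      using N\<epsilon> q1 by (intro mult_left_mono) auto
    also have "\<dots> \<le> ((p + 1) * n) * 2" using rank by (intro mult_right_mono) auto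
    also have "\<dots> = 2 * (p + 1) * n" by simp
    finally show "finite S \<and> real (card S) \<le> 2 * (p + 1) * real n"
      using fin by (simp add: N_def)
  qed
qed

end
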